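(* Let $\langle\chi,\vec a\rangle$ be a loop and $\check\phi$ a quantifier-free formula over $\vec x$, where $\chi(\vec x)\equiv\bigwedge_{i=1}^k C_i$ in CNF and, for each $i\in[1,k]$, $e_i(\vec x)>0$ is an inequation occurring in the clause $C_i$. Then mapping $(\langle\chi,\vec a\rangle,\check\phi)$ to \[ \bigwedge_{i=1}^k\Bigl(e_i(\vec x)>0\land\bigwedge_{x_j\in\mathit{closure}_{\vec a}(e_i)}x_j=a_j(\vec x)\Bigr) \] is a conditional non-termination technique; i.e., every $\vec x\in\mathbb Z^d$ that is a witness of non-termination for $\langle\check\phi,\vec a\rangle$ and satisfies this formula is a witness of non-termination for $\langle\chi,\vec a\rangle$.
   Context: Fix $d\ge 1$ and integer variables $\vec x=(x_1,\dots,x_d)$. A loop $\langle\chi,\vec a\rangle$ consists of a quantifier-free formula $\chi$ over atoms $p>0$ ($p$ an arithmetic expression over $\vec x$, integer semantics) and a map $\vec a=(a_1,\dots,a_d):\mathbb Z^d\to\mathbb Z^d$ given by expressions over $\vec x$; $\vec a^m$ is $m$-fold application ($\vec a^0=\mathrm{id}$). For an expression $e$, $\mathcal V(e)$ is the set of variables occurring in $e$, and $\mathit{closure}_{\vec a}(e):=\bigcup_{m\in\mathbb N}\mathcal V(e(\vec a^m(\vec x)))$, where $e(\vec a^m(\vec x))$ is the expression obtained from $e$ by substituting $\vec a^m(\vec x)$ for $\vec x$. A vector $\vec x\in\mathbb Z^d$ is a witness of non-termination for $\langle\chi,\vec a\rangle$ if $\chi(\vec a^m(\vec x))$ holds for all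 $m\in\mathbb N$. A conditional non-termination technique is a partial function $\mathit{nt}$ mapping pairs (loop $\langle\chi,\vec a\rangle$, quantifier-free formula $\check\phi$ over $\vec x$) to quantifier-free formulas over $\vec x$ such that for all pairs in its domain and all $\vec x$: if $\vec x$ is a witness of non-termination for $\langle\check\phi,\vec a\rangle$ and $\mathit{nt}(\langle\chi,\vec a\rangle,\check\phi)(\vec x)$ holds, then $\vec x$ is a witness of non-termination for $\langle\chi,\vec a\rangle$. *)

theory Defs
  imports Main
begin

text \<open>The variables \<open>x\<^sub>1, \<dots>, x\<^sub>d\<close> are indexed by a type \<open>'d\<close>, finite and linearly ordered in the
  main statement, with \<open>d = card (UNIV :: 'd set)\<close>; elements of \<open>\<int>\<^sup>d\<close> are functions \<open>'d \<Rightarrow> int\<close>.\<close>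

datatype 'd aexp =
    Const int
  | Var 'd
  | Add "'d aexp" "'d aexp"
  | Sub "'d aexp" "'d aexp"
  | Mul "'d aexp" "'d aexp"
  | Div "'d aexp" "'d aexp"
  | Pow "'d aexp" "'d aexp"

text \<open>Integer semantics: division is integer division (\<open>x div 0 = 0\<close>), and negative exponents
  are treated as \<open>0\<close>, so that every expression denotes a total function \<open>\<int>\<^sup>d \<rightarrow> \<int>\<close>.\<close>

primrec aval :: "'d aexp \<Rightarrow> ('d \<Rightarrow> int) \<Rightarrow> int" where
  "aval (Const c) x = c"
| "aval (Var j) x = x j"
| "aval (Add p q) x = aval p x + aval q x"
| "aval (Sub p q) x = aval p x - aval q x"
| "aval (Mul p q) x = aval p x * aval q x"
| "aval (Div p q) x = aval p x div aval q x"
| "aval (Pow p q) x = aval p x ^ nat (aval q x)"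

primrec vars :: "'d aexp \<Rightarrow> 'd set" where
  "vars (Const c) = {}"
| "vars (Var j) = {j}"
| "vars (Add p q) = vars p \<union> vars q"
| "vars (Sub p q) = vars p \<union> vars q"
| "vars (Mul p q) = vars p \<union> vars q"
| "vars (Div p q) = vars p \<union> vars q"
| "vars (Pow p q) = vars p \<union> vars q"

primrec subst :: "'d aexp \<Rightarrow> ('d \<Rightarrow> 'd aexp) \<Rightarrow> 'd aexp" where
  "subst (Const c) s = Const c"
| "subst (Var j) s = s j"
| "subst (Add p q) s = Add (subst p s) (subst q s)"
| "subst (Sub p q) s = Sub (subst p s) (subst q s)"
| "subst (Mul p q) s = Mul (subst p s) (subst q s)"
| "subst (Div p q) s = Div (subst p s) (subst q s)"
| "subst (Pow p q) s = Pow (subst p s) (subst q s)"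

text \<open>Quantifier-free formulas; \<open>Pos p\<close> is the atom \<open>p > 0\<close>.\<close>

datatype 'd qff =
    Top
  | Bot
  | Pos "'d aexp"
  | Neg "'d qff"
  | Conj "'d qff" "'d qff"
  | Disj "'d qff" "'d qff"

primrec sat :: "'d qff \<Rightarrow> ('d \<Rightarrow> int) \<Rightarrow> bool" where
  "sat Top x \<longleftrightarrow> True"
| "sat Bot x \<longleftrightarrow> False"
| "sat (Pos p) x \<longleftrightarrow> aval p x > 0"
| "sat (Neg F) x \<longleftrightarrow> \<not> sat F x"
| "sat (Conj F G) x \<longleftrightarrow> sat F x \<and> sat G x"
| "sat (Disj F G) x \<longleftrightarrow> sat F x \<or> sat G x"

definition Conjs :: "'d qff list \<Rightarrow> 'd qff" where
  "Conjs Fs = foldr Conj Fs Top"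

definition Disjs :: "'d qff list \<Rightarrow> 'd qff" where
  "Disjs Fs = foldr Disj Fs Bot"

text \<open>Over the integers, \<open>p = q\<close> holds iff \<open>p - q + 1 > 0\<close> and \<open>q - p + 1 > 0\<close>.\<close>

definition Eq :: "'d aexp \<Rightarrow> 'd aexp \<Rightarrow> 'd qff" where
  "Eq p q = Conj (Pos (Add (Sub p q) (Const 1))) (Pos (Add (Sub q p) (Const 1)))"

definition literal :: "'d qff \<Rightarrow> bool" where
  "literal F \<longleftrightarrow> (\<exists>p. F = Pos p \<or> F = Neg (Pos p))"

text \<open>The list \<open>Cs\<close> of clauses, each a list of literals, is a conjunctive normal form of \<open>F\<close>.
  This includes the case that \<open>F\<close> is syntactically the formula \<open>Conjs (map Disjs Cs)\<close>.\<close>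

definition is_cnf_of :: "'d qff list list \<Rightarrow> 'd qff \<Rightarrow> bool" where
  "is_cnf_of Cs F \<longleftrightarrow>
     (\<forall>C\<in>set Cs. \<forall>L\<in>set C. literal L) \<and>
     (\<forall>x. sat F x \<longleftrightarrow> sat (Conjs (map Disjs Cs)) x)"

text \<open>A loop is a pair of its guard and its update, the latter giving one expression per variable.\<close>

type_synonym 'd loop = "'d qff \<times> ('d \<Rightarrow> 'd aexp)"

definition update_map :: "('d \<Rightarrow> 'd aexp) \<Rightarrow> ('d \<Rightarrow> int) \<Rightarrow> ('d \<Rightarrow> int)" where
  "update_map a x = (\<lambda>j. aval (a j) x)"

fun nonterm_witness :: "'d loop \<Rightarrow> ('d \<Rightarrow> int) \<Rightarrow> bool" where
  "nonterm_witness (F, a) x \<longleftrightarrow> (\<forall>m. sat F ((update_map a ^^ m) x))"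

text \<open>The tuple of expressions \<open>a\<^sup>m(x)\<close>, obtained by purely syntactic substitution.\<close>

primrec update_iter :: "('d \<Rightarrow> 'd aexp) \<Rightarrow> nat \<Rightarrow> 'd \<Rightarrow> 'd aexp" where
  "update_iter a 0 = Var"
| "update_iter a (Suc m) = (\<lambda>j. subst (a j) (update_iter a m))"

definition closure :: "('d \<Rightarrow> 'd aexp) \<Rightarrow> 'd aexp \<Rightarrow> 'd set" where
  "closure a e = (\<Union>m. vars (subst e (update_iter a m)))"

definition conditional_nt_technique :: "('d loop \<times> 'd qff \<rightharpoonup> 'd qff) \<Rightarrow> bool" where
  "conditional_nt_technique nt \<longleftrightarrow>
     (\<forall>F a G H x. nt ((F, a), G) = Some H \<longrightarrow>
        nonterm_witness (G, a) x \<longrightarrow> sat H x \<longrightarrow> nonterm_witness (F, a) x)"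

definition fixpoint_formula :: "('d::{finite,linorder} \<Rightarrow> 'd aexp) \<Rightarrow> 'd aexp list \<Rightarrow> 'd qff" where
  "fixpoint_formula a es =
     Conjs (map (\<lambda>e. Conj (Pos e)
       (Conjs (map (\<lambda>j. Eq (Var j) (a j)) (sorted_list_of_set (closure a e))))) es)"

end

theory Submission imports Defs begin

text \<open>If \<open>a(x)\<close> and \<open>x\<close> agree on all variables of the expression \<open>e(a\<^sup>m(x))\<close>, then
  \<open>e(a\<^sup>m\<^sup>+\<^sup>1(x)) = e(a\<^sup>m(a(x))) = e(a\<^sup>m(x))\<close>. Hence \<open>e\<close> is constant along the orbit of \<open>x\<close> as soon
  as \<open>a\<close> fixes \<open>x\<close> on the closure of \<open>e\<close>, and one positive literal per clause stays true forever.\<close>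

lemma aval_subst: "aval (subst e s) x = aval e (\<lambda>j. aval (s j) x)"
  by (induction e) auto

lemma aval_cong: "\<forall>j\<in>vars e. x j = y j \<Longrightarrow> aval e x = aval e y"
  by (induction e) (simp_all add: ball_Un)

text \<open>Both recursions add the new application of \<open>a\<close> on the outside, so
  \<open>aval_subst\<close> carries the induction. This links the syntactic \<open>closure\<close>
  to the orbit.\<close>

lemma aval_update_iter: "(\<lambda>j. aval (update_iter a m j) x) = (update_map a ^^ m) x"
  by (induction m) (auto simp: aval_subst update_map_def)

lemma sat_Conjs: "sat (Conjs Fs) x \<longleftrightarrow> (\<forall>F\<in>set Fs. sat F x)"
  by (induction Fs) (auto simp: Conjs_def)

lemma sat_Disjs: "sat (Disjs Fs) x \<longleftrightarrow> (\<exists>F\<in>set Fs. sat F x)"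
  by (induction Fs) (auto simp: Disjs_def)

lemma sat_Eq: "sat (Eq p q) x \<longleftrightarrow> aval p x = aval q x"
  by (auto simp: Eq_def)

text \<open>As \<open>'d\<close> is finite, \<open>sorted_list_of_set\<close> lists exactly the
  elements of the closure.\<close>

lemma sat_fixpoint_formula:
  "sat (fixpoint_formula a es) x \<longleftrightarrow>
     (\<forall>e\<in>set es. aval e x > 0 \<and> (\<forall>j\<in>closure a e. update_map a x j = x j))"
  by (auto simp: fixpoint_formula_def sat_Conjs sat_Eq update_map_def)

lemma aval_orbit_const:
  assumes "\<And>j. j \<in> closure a e \<Longrightarrow> update_map a x j = x j"
  shows "aval e ((update_map a ^^ m) x) = aval e x"
proof (induction m)
  case (Suc m)
  let ?em = "subst e (update_iter a m)"
  \<comment> \<open>Needed for every \<open>y\<close>: it is used at \<open>x\<close> and at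
    \<open>update_map a x\<close>.\<close>
  have eval: "aval ?em y = aval e ((update_map a ^^ m) y)" for y
    by (simp add: aval_subst aval_update_iter)
  have "aval e ((update_map a ^^ Suc m) x) = aval ?em (update_map a x)"
    by (simp add: eval funpow_swap1)
  also have "\<dots> = aval ?em x"
    \<comment> \<open>The variables of \<open>?em\<close> form the \<open>m\<close>-th set in the
      union defining the closure.\<close>
    using assms by (intro aval_cong) (auto simp: closure_def)
  finally show ?case
    using Suc by (simp add: eval)
qed simp

theorem theorem18:
  fixes nt :: "('d::{finite,linorder}) loop \<times> 'd qff \<rightharpoonup> 'd qff"
  assumes "\<And>chi a phi psi. nt ((chi, a), phi) = Some psi \<Longrightarrow>
    \<exists>Cs es. is_cnf_of Cs chi \<and>
      length es = length Cs \<and> (\<forall>i<length Cs. Pos (es ! i) \<in> set (Cs ! i)) \<and>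
      psi = fixpoint_formula a es"
  shows "conditional_nt_technique nt"
  unfolding conditional_nt_technique_def
proof (intro allI impI)
  fix chi a phi psi x
  assume "nt ((chi, a), phi) = Some psi" and "sat psi x"
  then obtain Cs es where cnf: "is_cnf_of Cs chi" and len: "length es = length Cs"
    and lit: "\<forall>i<length Cs. Pos (es ! i) \<in> set (Cs ! i)"
    and sat: "sat (fixpoint_formula a es) x"
    using assms by blast
  have "sat (Disjs C) ((update_map a ^^ m) x)" if C: "C \<in> set Cs" for C m
  proof -
    obtain i where i: "i < length Cs" "C = Cs ! i"
      using C by (metis in_set_conv_nth)
    then have "es ! i \<in> set es"
      using len by simp
    then have "aval (es ! i) ((update_map a ^^ m) x) > 0"
      using sat by (simp add: sat_fixpoint_formula aval_orbit_const)
    then have "sat (Pos (es ! i)) ((update_map a ^^ m) x)"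
      by simp
    then show ?thesis
      using lit i unfolding sat_Disjs by blast
  qed
  then show "nonterm_witness (chi, a) x"
    \<comment> \<open>The CNF is equivalent to \<open>chi\<close> at every point, hence along the
      whole orbit.\<close>
    using cnf by (simp add: is_cnf_of_def sat_Conjs)
qed

end
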